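(* Let $X$ be a real Banach space with $\dim X\ge2$ and let $Y$ be a closed subspace of $X$ with $\dim Y\ge 2$. Then $$\mathrm{DR}_B(Y)\le \mathrm{DR}_B(X).$$
   Context: Birkhoff orthogonality: $x\perp_B y$ iff $\|x+\lambda y\|\ge\|x\|$ for all $\lambda\in\mathbb R$. For nonzero $x,y$ in a real Banach space $Z$ put $\alpha[x,y]=\left\|\frac{x}{\|x\|}-\frac{y}{\|y\|}\right\|$ and $\beta[x,y]=\left\|\frac{x}{\|y\|}-\frac{y}{\|x\|}\right\|$. The Birkhoff-orthogonal Dehghan--Rooin constant is $$\mathrm{DR}_B(Z)=\sup\left\{\frac{\alpha[x,y]}{\beta[x,y]}: x,y\in Z\setminus\{0\},\ x\perp_B y,\ \beta[x,y]\ne 0\right\}.$$ *)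

theory Defs
  imports "HOL-Analysis.Analysis"
begin

(* The library's dim returns 0 for subspaces without a finite basis, so dim Z \<ge> n is expressed
   by the existence of n linearly independent vectors, which also covers infinite dimension. *)
definition dim_at_least :: "nat \<Rightarrow> 'a::real_vector set \<Rightarrow> bool" where
  "dim_at_least n Z \<longleftrightarrow> (\<exists>B\<subseteq>Z. finite B \<and> card B = n \<and> independent B)"

definition birkhoff_orthogonal :: "'a::real_normed_vector \<Rightarrow> 'a \<Rightarrow> bool" (infix "\<bottom>\<^sub>B" 50) where
  "x \<bottom>\<^sub>B y \<longleftrightarrow> (\<forall>l::real. norm (x + l *\<^sub>R y) \<ge> norm x)"

definition angular_dist :: "'a::real_normed_vector \<Rightarrow> 'a \<Rightarrow> real" ("\<alpha>[_, _]") where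
  "\<alpha>[x, y] = norm (x /\<^sub>R norm x - y /\<^sub>R norm y)"

definition skew_angular_dist :: "'a::real_normed_vector \<Rightarrow> 'a \<Rightarrow> real" ("\<beta>[_, _]") where
  "\<beta>[x, y] = norm (x /\<^sub>R norm y - y /\<^sub>R norm x)"

(* A subspace Z is represented by its carrier set, with the norm inherited from the ambient type;
   the whole space is UNIV. *)
definition DR_B_ratios :: "'a::real_normed_vector set \<Rightarrow> real set" where
  "DR_B_ratios Z =
     {\<alpha>[x, y] / \<beta>[x, y] | x y. x \<in> Z - {0} \<and> y \<in> Z - {0} \<and> x \<bottom>\<^sub>B y \<and> \<beta>[x, y] \<noteq> 0}"

definition DR_B :: "'a::real_normed_vector set \<Rightarrow> real" where
  "DR_B Z = Sup (DR_B_ratios Z)"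

(* Sup on the reals is meaningful only for nonempty sets that are bounded above. The next two
   lemmas show that this is the case here. *)
lemma bdd_above_DR_B_ratios: "bdd_above (DR_B_ratios (Z :: 'a::real_normed_vector set))"
proof (rule bdd_aboveI)
  fix r assume "r \<in> DR_B_ratios Z"
  then obtain x y :: 'a where r: "r = \<alpha>[x, y] / \<beta>[x, y]" and xy: "x \<noteq> 0" "y \<noteq> 0" "x \<bottom>\<^sub>B y"
    unfolding DR_B_ratios_def by blast
  define t where "t = norm x / norm y"
  have t: "t > 0" using xy by (simp add: t_def)
  have "\<alpha>[x, y] \<le> norm (x /\<^sub>R norm x) + norm (y /\<^sub>R norm y)"
    unfolding angular_dist_def by (rule norm_triangle_ineq4)
  then have a: "\<alpha>[x, y] \<le> 2" using xy by simp
  have "x /\<^sub>R norm y - y /\<^sub>R norm x = (x + (- norm y / norm x) *\<^sub>R y) /\<^sub>R norm y"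
    using xy by (simp add: scaleR_diff_right divide_inverse)
  then have "\<beta>[x, y] = norm (x + (- norm y / norm x) *\<^sub>R y) / norm y"
    unfolding skew_angular_dist_def by (simp add: divide_inverse mult.commute)
  also have "\<dots> \<ge> norm x / norm y"
    using xy(3) unfolding birkhoff_orthogonal_def by (intro divide_right_mono norm_ge_zero) blast
  finally have b1: "\<beta>[x, y] \<ge> t" unfolding t_def .
  have "norm (y /\<^sub>R norm x) - norm (x /\<^sub>R norm y) \<le> \<beta>[x, y]"
    unfolding skew_angular_dist_def by (metis norm_minus_commute norm_triangle_ineq2)
  then have b2: "\<beta>[x, y] \<ge> 1 / t - t" by (simp add: t_def divide_inverse mult.commute)
  have b: "\<beta>[x, y] \<ge> 1 / 2"
  proof (cases "t \<ge> 1 / 2")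
    case False
    then have "1 / t \<ge> 2" using t by (simp add: field_simps)
    then show ?thesis using b2 False by linarith
  qed (use b1 in linarith)
  have "\<alpha>[x, y] / \<beta>[x, y] \<le> 2 / (1 / 2)" by (intro frac_le) (use a b in auto)
  then show "r \<le> 4" using r by simp
qed

lemma DR_B_ratios_nonempty:
  assumes "subspace Z" and "dim_at_least 2 Z"
  shows "DR_B_ratios Z \<noteq> {}"
proof -
  obtain B where B: "B \<subseteq> Z" "card B = 2" "independent B"
    using assms(2) unfolding dim_at_least_def by blast
  then obtain u v where uv: "B = {u, v}" "u \<noteq> v" by (auto simp: card_2_iff)
  have v0: "v \<noteq> 0" using B(3) uv dependent_zero by blast
  have nz: "u + l *\<^sub>R v \<noteq> 0" for l
  proof
    assume "u + l *\<^sub>R v = 0"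
    then have "u = (- l) *\<^sub>R v" by (simp add: add_eq_0_iff2)
    then have "u \<in> span {v}" by (metis span_base span_scale singletonI)
    moreover have "{u, v} - {u} = {v}" using uv by auto
    ultimately show False using B(3) uv(1) unfolding dependent_def by auto
  qed
  define f where "f l = norm (u + l *\<^sub>R v)" for l :: real
  define R where "R = 2 * norm u / norm v"
  have R: "R \<ge> 0" by (simp add: R_def)
  have "\<exists>m\<in>{-R..R}. \<forall>l\<in>{-R..R}. f m \<le> f l"
    unfolding f_def using R by (intro continuous_attains_inf) (auto intro!: continuous_intros)
  then obtain m where m: "\<And>l. \<bar>l\<bar> \<le> R \<Longrightarrow> f m \<le> f l" by (metis abs_le_iff atLeastAtMost_iff minus_le_iff)
  have min: "f m \<le> f l" for l
  proof (cases "\<bar>l\<bar> \<le> R")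
    case False
    have "2 * norm u \<le> \<bar>l\<bar> * norm v" using False v0 by (simp add: R_def field_simps)
    moreover have "norm (l *\<^sub>R v) - norm u \<le> f l"
      unfolding f_def by (metis add.commute norm_diff_ineq)
    ultimately have "f 0 \<le> f l" by (simp add: f_def)
    with m[of 0] R show ?thesis by simp
  qed (rule m)
  define w where "w = u + m *\<^sub>R v"
  have "norm w \<le> norm (w + l *\<^sub>R v)" for l
    using min[of "m + l"] by (simp add: f_def w_def scaleR_left_distrib add.assoc)
  then have orth: "w \<bottom>\<^sub>B v" unfolding birkhoff_orthogonal_def by blast
  have w0: "w \<noteq> 0" using nz by (simp add: w_def)
  have "w + (- norm v / norm w) *\<^sub>R v \<noteq> 0"
    using nz[of "m - norm v / norm w"] by (simp add: w_def scaleR_left_diff_distrib algebra_simps)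
  moreover have "w + (- norm v / norm w) *\<^sub>R v = norm v *\<^sub>R (w /\<^sub>R norm v - v /\<^sub>R norm w)"
    using v0 w0 by (simp add: scaleR_diff_right divide_inverse)
  ultimately have "\<beta>[w, v] \<noteq> 0" unfolding skew_angular_dist_def by auto
  moreover have "w \<in> Z" "v \<in> Z"
    using assms(1) B(1) uv(1) by (auto simp: w_def intro: subspace_add subspace_scale)
  ultimately show ?thesis unfolding DR_B_ratios_def using orth w0 v0 by blast
qed

end

theory Submission
  imports Defs
begin

text \<open>Birkhoff orthogonality, \<alpha> and \<beta> depend only on norms of combinations of x
  and y, so they do not change when the ambient space grows. Each admissible pair in
  \<open>Y\<close> thus stays admissible in \<open>UNIV\<close> with the same ratio, and a supremum
  over more ratios cannot be smaller.\<close>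

lemma DR_B_ratios_mono: "Y \<subseteq> Z \<Longrightarrow> DR_B_ratios Y \<subseteq> DR_B_ratios Z"
  unfolding DR_B_ratios_def by blast

theorem proposition2p7:
  fixes Y :: "'a::banach set"
  assumes "dim_at_least 2 (UNIV :: 'a set)"
    and "subspace Y" and "closed Y" and "dim_at_least 2 Y"
  shows "DR_B Y \<le> DR_B (UNIV :: 'a set)"
  unfolding DR_B_def
  \<comment> \<open>Real \<open>Sup\<close> is monotone only if the smaller set is nonempty, which
    two independent vectors of \<open>Y\<close> ensure, and the larger one is bounded above.\<close>
  using DR_B_ratios_nonempty[OF assms(2,4)] bdd_above_DR_B_ratios DR_B_ratios_mono[OF subset_UNIV]
  by (rule cSup_subset_mono)

end
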